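(* For all $m,n\ge 1$, $\gamma_{\rm i}(P_m\,\square\,P_n)=\alpha(P_m\,\square\,P_n)=\lceil mn/2\rceil$.
   Context: $P_m$ is the path on $m$ vertices, $\square$ denotes the Cartesian product of graphs (so $P_m\,\square\,P_n$ is the $m\times n$ grid), and $\alpha$ is the independence number. Indicated domination game on a graph $G$: two players, Dominator and Staller, alternate. In each round Dominator indicates a vertex $v$ not yet dominated by the vertices previously selected by Staller (a vertex dominates itself and its neighbors), and Staller must select a vertex of the closed neighborhood $N[v]$, adding it to a set $D$. The game ends when $D$ is a dominating set of $G$. Dominator wants to minimize $|D|$ and Staller to maximize it; the size of $D$ under optimal play of both is the indicated domination number $\gamma_{\rm i}(G)$. *)

theory Defs
  imports Complex_Main
begin

type_synonym 'a graph = "'a set \<times> ('a \<Rightarrow> 'a \<Rightarrow> bool)"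

definition verts :: "'a graph \<Rightarrow> 'a set" where
  "verts G = fst G"

definition adj :: "'a graph \<Rightarrow> 'a \<Rightarrow> 'a \<Rightarrow> bool" where
  "adj G = snd G"

definition path_graph :: "nat \<Rightarrow> nat graph" where
  "path_graph m = ({0..<m}, \<lambda>i j. i < m \<and> j < m \<and> (i + 1 = j \<or> j + 1 = i))"

definition cart_prod :: "'a graph \<Rightarrow> 'b graph \<Rightarrow> ('a \<times> 'b) graph" where
  "cart_prod G H = (verts G \<times> verts H,
     \<lambda>(g, h) (g', h'). (g = g' \<and> g \<in> verts G \<and> adj H h h') \<or>
                       (h = h' \<and> h \<in> verts H \<and> adj G g g'))"

definition closed_nbhd :: "'a graph \<Rightarrow> 'a \<Rightarrow> 'a set" where
  "closed_nbhd G v = {u \<in> verts G. u = v \<or> adj G v u}"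

definition dominated :: "'a graph \<Rightarrow> 'a set \<Rightarrow> 'a set" where
  "dominated G D = (\<Union>d\<in>D. closed_nbhd G d)"

definition dominating :: "'a graph \<Rightarrow> 'a set \<Rightarrow> bool" where
  "dominating G D \<longleftrightarrow> D \<subseteq> verts G \<and> verts G \<subseteq> dominated G D"

definition independent :: "'a graph \<Rightarrow> 'a set \<Rightarrow> bool" where
  "independent G S \<longleftrightarrow> S \<subseteq> verts G \<and> (\<forall>x\<in>S. \<forall>y\<in>S. \<not> adj G x y)"

definition independence_number :: "'a graph \<Rightarrow> nat" where
  "independence_number G = Max (card ` {S. independent G S})"

text \<open>Indicated domination game. dom_wins G D k means: from the position in
  which Staller has selected the set D, Dominator has a strategy ensuring that the game
  ends with a dominating set of size at most k, whatever Staller does.\<close>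
inductive dom_wins :: "'a graph \<Rightarrow> 'a set \<Rightarrow> nat \<Rightarrow> bool" for G where
  finished: "dominating G D \<Longrightarrow> card D \<le> k \<Longrightarrow> dom_wins G D k"
| move: "\<not> dominating G D \<Longrightarrow> v \<in> verts G \<Longrightarrow> v \<notin> dominated G D \<Longrightarrow>
         (\<forall>u \<in> closed_nbhd G v. dom_wins G (insert u D) k) \<Longrightarrow> dom_wins G D k"

text \<open>Indicated domination number: the size of D under optimal play of both players,
  i.e. the least k such that Dominator can guarantee |D| \<le> k.\<close>
definition indicated_domination_number :: "'a graph \<Rightarrow> nat" where
  "indicated_domination_number G = (LEAST k. dom_wins G {} k)"

end

theory Submission
  imports Defs
begin

text \<open>
  Lower bound: if Staller always answers inside a fixed maximum independent set \<open>I\<close>, the final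
  dominating set is contained in \<open>I\<close> and has to dominate \<open>I\<close>, so it equals \<open>I\<close>.

  Upper bound: call a cell \<open>(i, j)\<close> white if \<open>i + j\<close> is even and black otherwise. Dominator
  indicates undominated black cells as long as there are any, first the cells in even rows by
  increasing column, then the cells in odd rows along diagonals, by increasing \<open>i - j\<close>. Afterwards
  only undominated white cells are left. With this order the selected black cells inject into the
  dominated white cells that were not selected, so the total number of moves is at most the number
  of white cells.
\<close>

section \<open>Indicating vertices in a prescribed order\<close>

text \<open>Here any indication works: by symmetry the reply \<open>u\<close> dominates the
  indicated \<open>v\<close>, so the number of undominated vertices drops by at least one while
  \<open>card D\<close> grows by at most one.\<close>

lemma dom_wins_count:
  assumes "finite (verts G)" "D \<subseteq> verts G" "card D + card (verts G - dominated G D) \<le> k"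
    and sym: "\<And>u v. u \<in> closed_nbhd G v \<Longrightarrow> v \<in> closed_nbhd G u"
  shows "dom_wins G D k"
  using assms(2,3)
proof (induction "card (verts G - dominated G D)" arbitrary: D rule: less_induct)
  case less
  show ?case
  proof (cases "dominating G D")
    case True
    then show ?thesis using less.prems by (intro dom_wins.finished) auto
  next
    case False
    then obtain v where v: "v \<in> verts G" "v \<notin> dominated G D"
      using less.prems by (auto simp: dominating_def)
    have "dom_wins G (insert u D) k" if u: "u \<in> closed_nbhd G v" for u
    proof -
      have uV: "u \<in> verts G" using u by (auto simp: closed_nbhd_def)
      have "verts G - dominated G (insert u D) \<subset> verts G - dominated G D"
        using v sym[OF u] by (auto simp: dominated_def)
      then have lt: "card (verts G - dominated G (insert u D)) < card (verts G - dominated G D)"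
        using assms(1) by (intro psubset_card_mono) auto
      have "card (insert u D) \<le> Suc (card D)"
        by (rule card_insert_le_m1) auto
      then show ?thesis using less.hyps[OF lt] less.prems uV lt by simp
    qed
    then show ?thesis using False v by (intro dom_wins.move) auto
  qed
qed

text \<open>
  In a play in which Dominator indicates the vertices of \<open>S\<close> by increasing rank \<open>\<rho>\<close>, \<open>P\<close> is the set
  of vertices that were still undominated at their turn and \<open>s\<close> gives Staller's answers.
\<close>

lemma dom_wins_ordered:
  fixes \<rho> :: "'a \<Rightarrow> nat"
  assumes "finite (verts G)" "S \<subseteq> verts G" "D \<subseteq> verts G"
    and sym: "\<And>u v. u \<in> closed_nbhd G v \<Longrightarrow> v \<in> closed_nbhd G u"
    and "\<And>P s. \<lbrakk>P \<subseteq> S; \<And>v. v \<in> P \<Longrightarrow> s v \<in> closed_nbhd G v; P \<inter> dominated G D = {};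
           \<And>u v. \<lbrakk>u \<in> P; v \<in> P; \<rho> u < \<rho> v\<rbrakk> \<Longrightarrow> s u \<notin> closed_nbhd G v;
           S \<subseteq> dominated G (D \<union> s ` P)\<rbrakk>
         \<Longrightarrow> card (D \<union> s ` P) + card (verts G - dominated G (D \<union> s ` P)) \<le> k"
  shows "dom_wins G D k"
  using assms(2,3,5)
proof (induction "card S" arbitrary: S D)
  case 0
  then have "S = {}" using assms(1) finite_subset by fastforce
  then have "card D + card (verts G - dominated G D) \<le> k"
    using "0.prems"(3)[of "{}" id] by simp
  then show ?case using dom_wins_count[OF assms(1) "0.prems"(2) _ sym] by blast
next
  case (Suc c)
  have finS: "finite S" using Suc.prems(1) assms(1) finite_subset by blast
  have "S \<noteq> {}" using Suc.hyps by auto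
  then obtain v where v: "v \<in> S" and min: "\<And>u. u \<in> S \<Longrightarrow> \<rho> v \<le> \<rho> u"
    using arg_min_if_finite[OF finS, of \<rho>] by (meson not_le)
  have c: "c = card (S - {v})" using Suc.hyps v finS by simp
  have vV: "v \<in> verts G" using v Suc.prems(1) by auto
  note IH = Suc.hyps(1)[OF c]
  show ?case
  proof (cases "v \<in> dominated G D")
    case True
    \<comment> \<open>An already dominated \<open>v\<close> is skipped, so the same \<open>P\<close>
      and \<open>s\<close> describe the play for \<open>S\<close>.\<close>
    show ?thesis
    proof (rule IH)
      fix P s
      assume P: "P \<subseteq> S - {v}" "\<And>v. v \<in> P \<Longrightarrow> s v \<in> closed_nbhd G v" "P \<inter> dominated G D = {}"
        "\<And>u v. \<lbrakk>u \<in> P; v \<in> P; \<rho> u < \<rho> v\<rbrakk> \<Longrightarrow> s u \<notin> closed_nbhd G v"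
        "S - {v} \<subseteq> dominated G (D \<union> s ` P)"
      have "v \<in> dominated G (D \<union> s ` P)" using True by (auto simp: dominated_def)
      then show "card (D \<union> s ` P) + card (verts G - dominated G (D \<union> s ` P)) \<le> k"
        using P by (intro Suc.prems(3)) auto
    qed (use Suc.prems in auto)
  next
    case False
    have "dom_wins G (insert u D) k" if u: "u \<in> closed_nbhd G v" for u
    proof (rule IH)
      show "insert u D \<subseteq> verts G" using u Suc.prems(2) by (auto simp: closed_nbhd_def)
      fix P s
      assume P: "P \<subseteq> S - {v}" "\<And>v. v \<in> P \<Longrightarrow> s v \<in> closed_nbhd G v"
        "P \<inter> dominated G (insert u D) = {}"
        "\<And>u v. \<lbrakk>u \<in> P; v \<in> P; \<rho> u < \<rho> v\<rbrakk> \<Longrightarrow> s u \<notin> closed_nbhd G v"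
        "S - {v} \<subseteq> dominated G (insert u D \<union> s ` P)"
      \<comment> \<open>The current round is put in front of the remaining play. Since
        \<open>v\<close> has least rank, it can occur in the order condition only as the earlier
        vertex, and there the condition holds because \<open>P\<close> avoids what \<open>u\<close>
        dominates.\<close>
      let ?P = "insert v P" and ?s = "s(v := u)"
      have vP: "v \<notin> P" using P(1) by auto
      have eq: "D \<union> ?s ` ?P = insert u D \<union> s ` P" using vP by (auto simp: image_iff)
      have "card (D \<union> ?s ` ?P) + card (verts G - dominated G (D \<union> ?s ` ?P)) \<le> k"
      proof (rule Suc.prems(3))
        show "?P \<subseteq> S" using P(1) v by auto
        show "?s x \<in> closed_nbhd G x" if "x \<in> ?P" for x using that P(2) u by auto
        show "?P \<inter> dominated G D = {}" using P(3) False by (auto simp: dominated_def)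
        show "?s x \<notin> closed_nbhd G y" if "x \<in> ?P" "y \<in> ?P" "\<rho> x < \<rho> y" for x y
        proof (cases "x = v")
          case True
          then have "y \<in> P" using that by auto
          then have "y \<notin> closed_nbhd G u" using P(3) by (auto simp: dominated_def)
          then show ?thesis using True sym by auto
        next
          case False
          then have "x \<in> S" using that P(1) by auto
          then have "y \<noteq> v" using min[of x] that by auto
          then show ?thesis using False that P(4) by auto
        qed
        show "S \<subseteq> dominated G (D \<union> ?s ` ?P)"
          unfolding eq using P(5) sym[OF u] by (auto simp: dominated_def)
      qed
      then show "card (insert u D \<union> s ` P) + card (verts G - dominated G (insert u D \<union> s ` P)) \<le> k"
        unfolding eq .
    qed (use Suc.prems in auto)
    moreover have "\<not> dominating G D" using False vV by (auto simp: dominating_def)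
    ultimately show ?thesis using False vV by (intro dom_wins.move) auto
  qed
qed

section \<open>Independent sets bound the game from below\<close>

text \<open>As \<open>I\<close> meets every closed neighbourhood, Staller always has a reply in
  \<open>I\<close>, so the induction can keep \<open>D \<subseteq> I\<close> until the end of the
  game.\<close>

lemma dom_wins_ge_independent:
  assumes "dom_wins G D k" "D \<subseteq> I" "finite I" "independent G I"
    and "\<And>v. v \<in> verts G \<Longrightarrow> closed_nbhd G v \<inter> I \<noteq> {}"
  shows "card I \<le> k"
  using assms(1,2)
proof induction
  case (finished D k)
  have "I \<subseteq> D"
  proof
    fix x assume x: "x \<in> I"
    \<comment> \<open>The vertex \<open>d\<close> lies in \<open>I\<close> as well, and members of
      \<open>I\<close> are never adjacent, so \<open>d = x\<close>.\<close>
    then obtain d where "d \<in> D" "x \<in> closed_nbhd G d"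
      using finished assms(4) by (auto simp: dominating_def dominated_def independent_def)
    then show "x \<in> D"
      using x finished assms(4) by (auto simp: closed_nbhd_def independent_def)
  qed
  then have "I = D" using finished by auto
  then show ?case using finished by simp
next
  case (move D v k)
  then obtain u where "u \<in> closed_nbhd G v" "u \<in> I" using assms(5) by blast
  then show ?case using move by auto
qed

lemma independence_number_le_dom_wins:
  assumes "finite (verts G)" "dom_wins G {} k"
    and irrefl: "\<And>v. \<not> adj G v v" and sym: "\<And>u v. adj G u v \<Longrightarrow> adj G v u"
  shows "independence_number G \<le> k"
proof -
  have fin: "finite {S. independent G S}"
    by (rule finite_subset[of _ "Pow (verts G)"]) (use assms(1) in \<open>auto simp: independent_def\<close>)
  have "{} \<in> {S. independent G S}" by (simp add: independent_def)
  then obtain I where I: "independent G I" "card I = independence_number G"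
    using Max_in[of "card ` {S. independent G S}"] fin
    unfolding independence_number_def by fastforce
  have finI: "finite I" using I assms(1) by (auto simp: independent_def intro: finite_subset)
  \<comment> \<open>A maximum independent set is maximal: a vertex whose closed neighbourhood misses
    \<open>I\<close> could be added to it.\<close>
  have "closed_nbhd G v \<inter> I \<noteq> {}" if v: "v \<in> verts G" for v
  proof
    assume e: "closed_nbhd G v \<inter> I = {}"
    have IV: "I \<subseteq> verts G" using I by (simp add: independent_def)
    have "v \<notin> I" using e v by (auto simp: closed_nbhd_def)
    moreover have "independent G (insert v I)"
      using e I v irrefl sym IV by (fastforce simp: closed_nbhd_def independent_def)
    then have "card (insert v I) \<le> independence_number G"
      unfolding independence_number_def using fin by (intro Max_ge) auto
    ultimately show False using I finI by simp
  qed
  then show ?thesis using dom_wins_ge_independent[OF assms(2) _ finI I(1)] I by auto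
qed

section \<open>Grids\<close>

abbreviation grid :: "nat \<Rightarrow> nat \<Rightarrow> (nat \<times> nat) graph" where
  "grid m n \<equiv> cart_prod (path_graph m) (path_graph n)"

lemma verts_grid: "verts (grid m n) = {0..<m} \<times> {0..<n}"
  by (simp add: verts_def cart_prod_def path_graph_def)

lemma adj_grid:
  "adj (grid m n) (i, j) (i', j') \<longleftrightarrow> i < m \<and> i' < m \<and> j < n \<and> j' < n \<and>
     (i = i' \<and> (j + 1 = j' \<or> j' + 1 = j) \<or> j = j' \<and> (i + 1 = i' \<or> i' + 1 = i))"
  by (auto simp: adj_def verts_def cart_prod_def path_graph_def)

lemma closed_nbhd_grid:
  "(i', j') \<in> closed_nbhd (grid m n) (i, j) \<longleftrightarrow> i' < m \<and> j' < n \<and>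
     (i = i' \<and> j = j' \<or> adj (grid m n) (i, j) (i', j'))"
  by (auto simp: closed_nbhd_def verts_grid)

lemma adj_grid_sym: "adj (grid m n) u v \<Longrightarrow> adj (grid m n) v u"
  by (cases u; cases v) (auto simp: adj_grid)

lemma adj_grid_irrefl: "\<not> adj (grid m n) v v"
  by (cases v) (simp add: adj_grid)

lemma adj_grid_parity:
  "adj (grid m n) (i, j) (i', j') \<Longrightarrow> even (i' + j') \<longleftrightarrow> odd (i + j)"
  by (auto simp: adj_grid)

lemma closed_nbhd_grid_refl: "v \<in> verts (grid m n) \<Longrightarrow> v \<in> closed_nbhd (grid m n) v"
  by (simp add: closed_nbhd_def)

lemma closed_nbhd_grid_sym:
  "u \<in> closed_nbhd (grid m n) v \<Longrightarrow> v \<in> closed_nbhd (grid m n) u"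
  by (cases u; cases v) (auto simp: closed_nbhd_grid adj_grid)

section \<open>Chessboard colouring of the grid\<close>

definition white :: "nat \<Rightarrow> nat \<Rightarrow> (nat \<times> nat) set" where
  "white m n = {(i, j). i < m \<and> j < n \<and> even (i + j)}"

definition black :: "nat \<Rightarrow> nat \<Rightarrow> (nat \<times> nat) set" where
  "black m n = {(i, j). i < m \<and> j < n \<and> odd (i + j)}"

lemma verts_grid_colours: "verts (grid m n) = white m n \<union> black m n"
  by (auto simp: verts_grid white_def black_def)

lemma finite_white: "finite (white m n)"
  using verts_grid_colours[of m n] by (metis finite_Un finite_SigmaI finite_atLeastLessThan verts_grid)

lemma finite_black: "finite (black m n)"
  using verts_grid_colours[of m n] by (metis finite_Un finite_SigmaI finite_atLeastLessThan verts_grid)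

text \<open>Counts the white cells of row \<open>i\<close>. An even row starts with a white cell, so
  it has the extra one when \<open>n\<close> is odd.\<close>

lemma card_even_shift: "card {j. j < n \<and> even (i + j)} = (if even i then (n + 1) div 2 else n div 2)"
  for i n :: nat
proof (induction n)
  case (Suc n)
  show ?case
  proof (cases "even (i + n)")
    case True
    then have "{j. j < Suc n \<and> even (i + j)} = insert n {j. j < n \<and> even (i + j)}"
      by (auto simp: less_Suc_eq)
    then have "card {j. j < Suc n \<and> even (i + j)} = Suc (card {j. j < n \<and> even (i + j)})"
      by simp
    then show ?thesis unfolding Suc using True by (auto elim: evenE oddE)
  next
    case False
    then have "{j. j < Suc n \<and> even (i + j)} = {j. j < n \<and> even (i + j)}"
      by (auto simp: less_Suc_eq)
    then have "card {j. j < Suc n \<and> even (i + j)} = card {j. j < n \<and> even (i + j)}"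
      by simp
    then show ?thesis unfolding Suc using False by (auto elim: evenE oddE)
  qed
qed simp

lemma card_white: "card (white m n) = (m * n + 1) div 2"
proof -
  have "white m n = Sigma {..<m} (\<lambda>i. {j. j < n \<and> even (i + j)})"
    by (auto simp: white_def)
  then have "card (white m n) = (\<Sum>i<m. if even i then (n + 1) div 2 else n div 2)"
    by (simp add: card_SigmaI card_even_shift del: even_add)
  also have "\<dots> = (m * n + 1) div 2"
  proof (induction m)
    case (Suc m)
    show ?case
    proof (cases "even m")
      case True
      \<comment> \<open>Two consecutive rows together hold \<open>n\<close> white cells, so the
        first \<open>2 * q\<close> rows hold \<open>q * n\<close>.\<close>
      then obtain q where "m = 2 * q" by blast
      then show ?thesis using Suc by simp
    next
      case False
      then obtain q where "m = 2 * q + 1" by (blast elim: oddE)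
      then show ?thesis using Suc by (simp add: algebra_simps)
    qed
  qed simp
  finally show ?thesis .
qed

lemma independent_white: "independent (grid m n) (white m n)"
proof -
  have "\<not> adj (grid m n) u v" if "u \<in> white m n" "v \<in> white m n" for u v
    using that adj_grid_parity[of m n "fst u" "snd u" "fst v" "snd v"] by (auto simp: white_def)
  then show ?thesis by (auto simp: independent_def verts_grid_colours)
qed

section \<open>Counting the cells selected in a play\<close>

text \<open>Inside the grid, ranks in even rows stay below \<open>n\<close>, and the offset
  \<open>n\<close> puts all odd rows after them. Writing \<open>n - j\<close> keeps the order by
  \<open>i - j\<close> within the natural numbers.\<close>

definition grid_rank :: "nat \<Rightarrow> nat \<times> nat \<Rightarrow> nat" where
  "grid_rank n = (\<lambda>(i, j). if even i then j else n + (i + (n - j)))"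

text \<open>White cells are undominated, selected, or dominated but unselected. All undominated
  cells are white by \<open>dom\<close>, so the claim amounts to the third class being at least as
  large as the set of selected black cells. An injection \<open>\<phi>\<close> into that class shows
  this.\<close>

lemma black_play_card_le:
  fixes s :: "nat \<times> nat \<Rightarrow> nat \<times> nat"
  assumes PB: "P \<subseteq> black m n"
    and s: "\<And>v. v \<in> P \<Longrightarrow> s v \<in> closed_nbhd (grid m n) v"
    and ord: "\<And>u v. \<lbrakk>u \<in> P; v \<in> P; grid_rank n u < grid_rank n v\<rbrakk>
                \<Longrightarrow> s u \<notin> closed_nbhd (grid m n) v"
    and dom: "black m n \<subseteq> dominated (grid m n) (s ` P)"
  shows "card (s ` P) + card (verts (grid m n) - dominated (grid m n) (s ` P)) \<le> card (white m n)"
proof -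
  let ?D = "s ` P" and ?dom = "dominated (grid m n) (s ` P)"
  have finP: "finite P" using PB finite_black finite_subset by blast
  have P_black: "i < m \<and> j < n \<and> odd (i + j)" if "(i, j) \<in> P" for i j
    using that PB by (auto simp: black_def)
  have D_verts: "?D \<subseteq> verts (grid m n)" using s by (auto simp: closed_nbhd_def)
  \<comment> \<open>Neighbours of a black cell are white, so a black cell can only be the reply to
    its own indication.\<close>
  have black_selected: "(i, j) \<in> P \<and> s (i, j) = (i, j)" if d: "(i, j) \<in> ?D" "odd (i + j)" for i j
  proof -
    obtain i' j' where u: "(i', j') \<in> P" "s (i', j') = (i, j)" using d by force
    then have "(i, j) \<in> closed_nbhd (grid m n) (i', j')" using s by metis
    then show ?thesis
      using u P_black[OF u(1)] d(2) adj_grid_parity[of m n i' j' i j] by (auto simp: closed_nbhd_grid)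
  qed
  have white_selected: "\<exists>i' j'. (i', j') \<in> P \<and> s (i', j') = (i, j) \<and> adj (grid m n) (i', j') (i, j)"
    if d: "(i, j) \<in> ?D" "even (i + j)" for i j
  proof -
    obtain i' j' where u: "(i', j') \<in> P" "s (i', j') = (i, j)" using d by force
    then have "(i, j) \<in> closed_nbhd (grid m n) (i', j')" using s by metis
    then show ?thesis using u P_black[OF u(1)] d(2) by (auto simp: closed_nbhd_grid)
  qed
  \<comment> \<open>The reply \<open>w\<close> to \<open>u\<close> dominates its neighbour
    \<open>v\<close>, so \<open>v\<close> could not have been undominated at a turn strictly after
    \<open>u\<close>.\<close>
  have no_earlier: "grid_rank n v \<le> grid_rank n u"
    if "u \<in> P" "v \<in> P" "s u = w" "adj (grid m n) v w" for u v w
    using ord[of u v] that by (cases v; cases w) (fastforce simp: closed_nbhd_grid adj_grid)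
  text \<open>The upper and the right neighbour of a cell in an odd row have no later black neighbour.\<close>
  have up: "s (i, j) = (i - 1, j)" if t: "(i, j) \<in> P" "odd i" "(i - 1, j) \<in> ?D" for i j
  proof -
    have ij: "i < m" "j < n" "even j" "i \<ge> 1" using P_black[OF t(1)] t(2) by (auto elim: oddE)
    obtain i' j' where u: "(i', j') \<in> P" "s (i', j') = (i - 1, j)"
        "adj (grid m n) (i', j') (i - 1, j)"
      using white_selected[OF t(3)] ij t(2) by auto
    have "grid_rank n (i, j) \<le> grid_rank n (i', j')"
      using no_earlier[OF u(1) t(1) u(2)] ij by (auto simp: adj_grid)
    then have "(i', j') = (i, j)"
      using u(3) ij t(2) by (auto simp: grid_rank_def adj_grid split: if_splits)
    then show ?thesis using u by simp
  qed
  have right: "s (i, j) = (i, j + 1)" if t: "(i, j) \<in> P" "odd i" "(i, j + 1) \<in> ?D" for i j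
  proof -
    have ij: "i < m" "j < n" "even j" "i \<ge> 1" using P_black[OF t(1)] t(2) by (auto elim: oddE)
    obtain i' j' where u: "(i', j') \<in> P" "s (i', j') = (i, j + 1)"
        "adj (grid m n) (i', j') (i, j + 1)"
      using white_selected[OF t(3)] ij t(2) by auto
    have "grid_rank n (i, j) \<le> grid_rank n (i', j')"
      using no_earlier[OF u(1) t(1) u(2)] u(3) ij by (auto simp: adj_grid)
    then have "(i', j') = (i, j)"
      using u(3) ij t(2) by (auto simp: grid_rank_def adj_grid split: if_splits)
    then show ?thesis using u by simp
  qed
  \<comment> \<open>Of the black neighbours of \<open>(i, j - 1)\<close>, the cell
    \<open>(i, j)\<close> selects itself and \<open>(i, j - 2)\<close> has smaller rank, which
    leaves the two in odd rows.\<close>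
  have left: "(i + 1, j - 1) \<in> P \<and> s (i + 1, j - 1) = (i, j - 1) \<or>
              (i - 1, j - 1) \<in> P \<and> s (i - 1, j - 1) = (i, j - 1)"
    if t: "(i, j) \<in> ?D" "even i" "odd j" "(i, j - 1) \<in> ?D" for i j
  proof -
    have b: "(i, j) \<in> P" "s (i, j) = (i, j)" using black_selected[OF t(1)] t by auto
    have ij: "i < m" "j < n" "j \<ge> 1" using P_black[OF b(1)] t by (auto elim: oddE)
    obtain i' j' where u: "(i', j') \<in> P" "s (i', j') = (i, j - 1)"
        "adj (grid m n) (i', j') (i, j - 1)"
      using white_selected[OF t(4)] ij t by auto
    have "grid_rank n (i, j) \<le> grid_rank n (i', j')"
      using no_earlier[OF u(1) b(1) u(2)] ij by (auto simp: adj_grid)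
    moreover have "(i', j') \<noteq> (i, j)" using u(2) b ij by auto
    ultimately have "(i', j') = (i + 1, j - 1) \<or> (i', j') = (i - 1, j - 1)"
      using u(3) ij t(2,3) by (auto simp: grid_rank_def adj_grid split: if_splits)
    then show ?thesis using u by auto
  qed
  \<comment> \<open>Odd rows map upwards. An even-row cell maps to its left neighbour unless that is
    taken: it moves down if \<open>(i + 1, j - 1)\<close> selected the left neighbour, or selected
    itself and so has it as its own image, and it moves up if \<open>(i - 1, j - 1)\<close> selected
    it.\<close>
  define \<phi> where "\<phi> = (\<lambda>(i, j). if odd i then (i - 1, j)
    else if (i + 1, j - 1) \<in> P \<and> s (i + 1, j - 1) \<in> {(i + 1, j - 1), (i, j - 1)} then (i + 1, j)
    else if (i - 1, j - 1) \<in> P \<and> s (i - 1, j - 1) = (i, j - 1) then (i - 1, j)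
    else (i, j - 1))"
  let ?DB = "?D \<inter> black m n" and ?DW = "?D \<inter> white m n"
  have \<phi>_odd: "\<phi> (i, j) = (i - 1, j)" "i \<ge> 1" if "odd i" for i j
    using that by (auto simp: \<phi>_def elim: oddE)
  have \<phi>_even: "(\<phi> (i, j) = (i + 1, j) \<and> (i + 1, j - 1) \<in> P \<and>
        s (i + 1, j - 1) \<in> {(i + 1, j - 1), (i, j - 1)}) \<or>
      (\<phi> (i, j) = (i - 1, j) \<and> i \<ge> 1 \<and> (i - 1, j - 1) \<in> P \<and> s (i - 1, j - 1) = (i, j - 1)) \<or>
      (\<phi> (i, j) = (i, j - 1) \<and> \<not> ((i + 1, j - 1) \<in> P \<and> s (i + 1, j - 1) \<in> {(i + 1, j - 1), (i, j - 1)}) \<and>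
        \<not> ((i - 1, j - 1) \<in> P \<and> s (i - 1, j - 1) = (i, j - 1)))"
    if "even i" "odd j" for i j
  proof -
    \<comment> \<open>For \<open>i = 0\<close> truncated subtraction would give
      \<open>(0, j - 1)\<close>, which is white and hence outside \<open>P\<close>.\<close>
    have "i \<ge> 1" if "(i - 1, j - 1) \<in> P"
      using P_black[OF that] \<open>odd j\<close> by (cases i) auto
    then show ?thesis using that unfolding \<phi>_def by auto
  qed
  have inj: "inj_on \<phi> ?DB"
  proof (rule inj_onI)
    fix x y assume x: "x \<in> ?DB" and y: "y \<in> ?DB" and eq: "\<phi> x = \<phi> y"
    have fixed: "(i, j) \<in> P" "s (i, j) = (i, j)" "odd i \<longleftrightarrow> even j" if "(i, j) \<in> ?DB" for i j
      using that black_selected[of i j] by (auto simp: black_def)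
    have mixed: "\<phi> (i, j) \<noteq> \<phi> (k, l)" if "(i, j) \<in> ?DB" "(k, l) \<in> ?DB" "odd i" "even k" for i j k l
    proof
      assume e: "\<phi> (i, j) = \<phi> (k, l)"
      have l: "odd l" and j: "even j" using fixed(3)[OF that(2)] fixed(3)[OF that(1)] that by auto
      \<comment> \<open>Row parity forces the image of \<open>(k, l)\<close> to be its left
        neighbour. But \<open>(i, j) = (k + 1, l - 1)\<close> selected itself, which is the case
        where \<open>\<phi>\<close> moves down.\<close>
      have "k + 1 = i" "l - 1 = j"
        using \<phi>_even[OF that(4) l] \<phi>_odd[OF that(3)] j l e by auto
      then show False
        using \<phi>_even[OF that(4) l] \<phi>_odd[OF that(3)] j l e fixed[OF that(1)] by auto
    qed
    have both_even: "(i, j) = (k, l)"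
      if "(i, j) \<in> ?DB" "(k, l) \<in> ?DB" "even i" "even k" "\<phi> (i, j) = \<phi> (k, l)" for i j k l
    proof -
      have jl: "odd j" "odd l" using fixed[OF that(1)] fixed[OF that(2)] that by auto
      then have pos: "j \<ge> 1" "l \<ge> 1" by (auto elim: oddE)
      \<comment> \<open>Column parity separates left images from vertical ones. A downward and an
        upward image can only coincide if the black cell to their left gave two different
        answers.\<close>
      show ?thesis
        using \<phi>_even[OF that(3) jl(1)] \<phi>_even[OF that(4) jl(2)] that(3-5) jl pos
        by (elim disjE conjE) (auto dest: arg_cong[of _ _ even])
    qed
    obtain i j k l where xy: "x = (i, j)" "y = (k, l)" by (cases x; cases y)
    consider "odd i" "odd k" | "odd i" "even k" | "even i" "odd k" | "even i" "even k" by blast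
    then show "x = y"
    proof cases
      case 1
      then show ?thesis using eq \<phi>_odd(2)[of i] \<phi>_odd(2)[of k] by (auto simp: xy \<phi>_odd(1))
    next
      case 2
      then show ?thesis using mixed[of i j k l] x y eq xy by simp
    next
      case 3
      then show ?thesis using mixed[of k l i j] x y eq xy by simp
    next
      case 4
      then show ?thesis using both_even[of i j k l] x y eq xy by simp
    qed
  qed
  have img: "\<phi> ` ?DB \<subseteq> (white m n \<inter> ?dom) - ?D"
  proof
    fix w assume "w \<in> \<phi> ` ?DB"
    then obtain i j where ij: "(i, j) \<in> ?D" "(i, j) \<in> black m n" and w: "w = \<phi> (i, j)" by auto
    have lt: "i < m" "j < n" "odd (i + j)" using ij by (auto simp: black_def)
    have b: "(i, j) \<in> P" "s (i, j) = (i, j)" using black_selected[OF ij(1) lt(3)] by auto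
    have nb: "w \<in> white m n \<inter> ?dom" if "adj (grid m n) (i, j) w"
    proof -
      obtain k l where kl: "w = (k, l)" by (cases w)
      have "w \<in> white m n"
        using that adj_grid_parity[of m n i j k l] lt(3) by (auto simp: kl white_def adj_grid)
      moreover have "w \<in> closed_nbhd (grid m n) (i, j)"
        using that by (auto simp: kl closed_nbhd_grid adj_grid)
      ultimately show ?thesis using ij(1) unfolding dominated_def by blast
    qed
    show "w \<in> (white m n \<inter> ?dom) - ?D"
    proof (cases "odd i")
      case True
      then have "w = (i - 1, j)" "i \<ge> 1" using \<phi>_odd w by auto
      \<comment> \<open>By \<open>up\<close>, a selected \<open>(i - 1, j)\<close> would be the
        answer to \<open>(i, j)\<close>, which selected itself.\<close>
      moreover have "(i - 1, j) \<notin> ?D" using up[OF b(1) True] b(2) \<open>i \<ge> 1\<close> by auto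
      ultimately show ?thesis using nb lt by (auto simp: adj_grid)
    next
      case False
      then have par: "even i" "odd j" "j \<ge> 1" using lt by (auto elim: oddE)
      consider (below) "(i + 1, j - 1) \<in> P" "s (i + 1, j - 1) \<in> {(i + 1, j - 1), (i, j - 1)}" "w = (i + 1, j)"
        | (above) "(i - 1, j - 1) \<in> P" "s (i - 1, j - 1) = (i, j - 1)" "w = (i - 1, j)" "i \<ge> 1"
        | (beside) "w = (i, j - 1)" "\<not> ((i + 1, j - 1) \<in> P \<and> s (i + 1, j - 1) = (i, j - 1))"
            "\<not> ((i - 1, j - 1) \<in> P \<and> s (i - 1, j - 1) = (i, j - 1))"
        using \<phi>_even[OF par(1,2)] unfolding w by blast
      then show ?thesis
      proof cases
        case below
        \<comment> \<open>The cell \<open>w\<close> is the right neighbour of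
          \<open>(i + 1, j - 1)\<close>, so by \<open>right\<close> only that cell could have
          selected it, but its answer was another one.\<close>
        have "w \<notin> ?D"
        proof
          assume "w \<in> ?D"
          then have "s (i + 1, j - 1) = (i + 1, j)"
            using right[OF below(1)] below(3) par by simp
          then show False using below(2) par by auto
        qed
        moreover have "i + 1 < m" using P_black[OF below(1)] by auto
        ultimately show ?thesis using nb lt below by (auto simp: adj_grid)
      next
        case above
        have "w \<notin> ?D"
        proof
          assume "w \<in> ?D"
          then have "s (i - 1, j - 1) = (i - 1, j)"
            using right[OF above(1)] above(3,4) par by simp
          then show False using above(2,4) par by auto
        qed
        then show ?thesis using nb lt above by (auto simp: adj_grid)
      next
        case beside
        \<comment> \<open>The two negated conditions exclude exactly the alternatives in
          \<open>left\<close>.\<close>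
        then have "w \<notin> ?D" using left[OF ij(1)] par by auto
        then show ?thesis using nb lt beside par by (auto simp: adj_grid)
      qed
    qed
  qed
  have "card ?DB \<le> card ((white m n \<inter> ?dom) - ?D)"
    using card_inj_on_le[OF inj img] finite_white by auto
  moreover have "card ?D = card ?DB + card ?DW"
  proof -
    have "?D = ?DB \<union> ?DW" "?DB \<inter> ?DW = {}"
      using D_verts by (auto simp: white_def black_def verts_grid)
    then show ?thesis using card_Un_disjoint[of ?DB ?DW] finP by auto
  qed
  moreover have "card (white m n \<inter> ?dom) = card ((white m n \<inter> ?dom) - ?D) + card ?DW"
  proof -
    have sub: "?DW \<subseteq> white m n \<inter> ?dom"
      using D_verts closed_nbhd_grid_refl by (fastforce simp: dominated_def)
    have "white m n \<inter> ?dom = ((white m n \<inter> ?dom) - ?D) \<union> ?DW" using sub by auto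
    moreover have "card (((white m n \<inter> ?dom) - ?D) \<union> ?DW) = card ((white m n \<inter> ?dom) - ?D) + card ?DW"
      using finite_white finP by (intro card_Un_disjoint) auto
    ultimately show ?thesis by simp
  qed
  moreover have "verts (grid m n) - ?dom = white m n - ?dom"
    using dom verts_grid_colours by blast
  moreover have "card (white m n) = card (white m n \<inter> ?dom) + card (white m n - ?dom)"
    using card_Un_disjoint[of "white m n \<inter> ?dom" "white m n - ?dom"] finite_white
    by (simp add: Int_Diff_Un Int_Diff_disjoint)
  ultimately show ?thesis by simp
qed

lemma dom_wins_grid: "dom_wins (grid m n) {} (card (white m n))"
proof (rule dom_wins_ordered[where S = "black m n" and \<rho> = "grid_rank n"])
  show "finite (verts (grid m n))" by (simp add: verts_grid)
  show "black m n \<subseteq> verts (grid m n)" by (simp add: verts_grid_colours)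
  show "u \<in> closed_nbhd (grid m n) v \<Longrightarrow> v \<in> closed_nbhd (grid m n) u" for u v
    by (rule closed_nbhd_grid_sym)
  fix P s
  assume "P \<subseteq> black m n" "\<And>v. v \<in> P \<Longrightarrow> s v \<in> closed_nbhd (grid m n) v"
    "\<And>u v. \<lbrakk>u \<in> P; v \<in> P; grid_rank n u < grid_rank n v\<rbrakk> \<Longrightarrow> s u \<notin> closed_nbhd (grid m n) v"
    "black m n \<subseteq> dominated (grid m n) ({} \<union> s ` P)"
  then show "card ({} \<union> s ` P) + card (verts (grid m n) - dominated (grid m n) ({} \<union> s ` P))
      \<le> card (white m n)"
    unfolding Un_empty_left by (rule black_play_card_le)
qed simp

theorem theorem5p4:
  fixes m n :: nat
  assumes "m \<ge> 1" and "n \<ge> 1"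
  shows "indicated_domination_number (cart_prod (path_graph m) (path_graph n)) =
           independence_number (cart_prod (path_graph m) (path_graph n))
       \<and> independence_number (cart_prod (path_graph m) (path_graph n)) =
           nat \<lceil>real (m * n) / 2\<rceil>"
proof -
  have fin: "finite (verts (grid m n))" by (simp add: verts_grid)
  have le: "independence_number (grid m n) \<le> k" if "dom_wins (grid m n) {} k" for k
    by (rule independence_number_le_dom_wins[OF fin that adj_grid_irrefl adj_grid_sym])
  have "finite {S. independent (grid m n) S}"
    by (rule finite_subset[of _ "Pow (verts (grid m n))"]) (use fin in \<open>auto simp: independent_def\<close>)
  then have "card (white m n) \<le> independence_number (grid m n)"
    unfolding independence_number_def using independent_white by (intro Max_ge) auto
  \<comment> \<open>The upper bound on the independence number comes from the game itself, since
    Dominator can never guarantee less than that number.\<close>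
  then have \<alpha>: "independence_number (grid m n) = card (white m n)"
    using le[OF dom_wins_grid] by simp
  have "indicated_domination_number (grid m n) = card (white m n)"
    unfolding indicated_domination_number_def
    using dom_wins_grid le \<alpha> by (intro Least_equality) auto
  moreover have "nat \<lceil>real (m * n) / 2\<rceil> = (m * n + 1) div 2"
    by linarith
  ultimately show ?thesis using \<alpha> card_white by simp
qed

end
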